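(* Let $q\ge 1$, let $\mathbf{c},\mathbf{v}_0\in\mathbb{R}^d$ with $\mathbf{c}>0$ and $\mathbf{v}_0>0$ (componentwise), let $u>0$, let $f(\mathbf{x}):=(\mathbf{c}^{\top}\mathbf{x})^q$ and $Q:=Q_u:=\mathbf{v}_0+u[0,1]^d$, and let $\mu$ be a concave upper bound of $f$ on $Q$. Let $P=P(f,Q)$ and $P^0=P^0(f,Q)$ be the perspective and naïve relaxations (both defined using $\mu$), and let $\Delta(P^0,P):=\operatorname{vol}(P^0)-\operatorname{vol}(P)$. Then $$\Delta(P^0,P)=\frac{q-1}{(d+2)(q+d+1)}\,u^{q+d}\int_{[0,1]^d}\left(\mathbf{c}^{\top}\mathbf{y}+\frac{\mathbf{c}^{\top}\mathbf{v}_0}{u}\right)^q d\mathbf{y}.$$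
   Context: A concave upper bound of $f$ on $Q$ is a concave function $\mu:Q\to\mathbb{R}$ with $\mu(\mathbf{x})\ge f(\mathbf{x})$ for all $\mathbf{x}\in Q$. For $z>0$ and $\mathbf{x}\in z\cdot Q=\{z\mathbf{q}:\mathbf{q}\in Q\}$ write $\tilde f(\mathbf{x},z):=z f(\mathbf{x}/z)$ and $\tilde\mu(\mathbf{x},z):=z\mu(\mathbf{x}/z)$, and (closure convention) $\tilde\mu(\mathbf{0},0):=0$. The perspective relaxation is $$P(f,Q):=\operatorname{convcl}\{(\mathbf{x},y,z)\in\mathbb{R}^d\times\mathbb{R}\times\mathbb{R}:\ \tilde\mu(\mathbf{x},z)\ge y\ge\tilde f(\mathbf{x},z),\ \mathbf{x}\in z\cdot Q,\ 1\ge z>0\},$$ where $\operatorname{convcl}$ denotes the closure of the convex hull, and the naïve relaxation is $$P^0(f,Q):=\{(\mathbf{x},y,z)\in\mathbb{R}^d\times\mathbb{R}\times\mathbb{R}:\ \tilde\mu(\mathbf{x},z)\ge y\ge f(\mathbf{x}),\ \mathbf{x}\in z\cdot Q,\ 1\ge z\ge 0\}.$$ $\operatorname{vol}$ denotes Lebesgue measure in $\mathbb{R}^{d+2}$. *)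

theory Defs
  imports "HOL-Analysis.Analysis"
begin

definition concave_upper_bound ::
  "('a::real_vector \<Rightarrow> real) \<Rightarrow> 'a set \<Rightarrow> ('a \<Rightarrow> real) \<Rightarrow> bool" where
  "concave_upper_bound f Q \<mu> \<longleftrightarrow> concave_on Q \<mu> \<and> (\<forall>x\<in>Q. f x \<le> \<mu> x)"

text \<open>The value at \<open>z = 0\<close> is the closure convention; it is only ever used at \<open>x = 0\<close>.\<close>

definition perspective :: "('a::real_vector \<Rightarrow> real) \<Rightarrow> 'a \<Rightarrow> real \<Rightarrow> real" where
  "perspective g x z = (if z = 0 then 0 else z * g (x /\<^sub>R z))"

text \<open>Functions are total here, but both relaxations depend on \<open>\<mu>\<close> only through its
  values on \<open>Q\<close>, because \<open>x /\<^sub>R z \<in> Q\<close> whenever \<open>x \<in> z \<cdot> Q\<close> and \<open>z > 0\<close>.\<close>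

definition perspective_relaxation ::
  "('a::euclidean_space \<Rightarrow> real) \<Rightarrow> ('a \<Rightarrow> real) \<Rightarrow> 'a set \<Rightarrow> ('a \<times> real \<times> real) set" where
  "perspective_relaxation f \<mu> Q = closure (convex hull
     {(x, y, z). perspective \<mu> x z \<ge> y \<and> y \<ge> perspective f x z \<and>
                 x \<in> (\<lambda>q. z *\<^sub>R q) ` Q \<and> 1 \<ge> z \<and> z > 0})"

definition naive_relaxation ::
  "('a::euclidean_space \<Rightarrow> real) \<Rightarrow> ('a \<Rightarrow> real) \<Rightarrow> 'a set \<Rightarrow> ('a \<times> real \<times> real) set" where
  "naive_relaxation f \<mu> Q =
     {(x, y, z). perspective \<mu> x z \<ge> y \<and> y \<ge> f x \<and>
                 x \<in> (\<lambda>q. z *\<^sub>R q) ` Q \<and> 1 \<ge> z \<and> z \<ge> 0}"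

definition vol_diff :: "'a::euclidean_space set \<Rightarrow> 'a set \<Rightarrow> real" where
  "vol_diff A B = measure lebesgue A - measure lebesgue B"

text \<open>The real power \<open>powr\<close> agrees with the usual one for nonnegative bases and positive
  exponents, including \<open>0 powr q = 0\<close>; the relaxations evaluate \<open>linear_power c q\<close> only at
  points with \<open>c \<bullet> x \<ge> 0\<close> when \<open>c\<close> and \<open>v\<^sub>0\<close> are positive.\<close>

definition linear_power :: "real ^ 'n \<Rightarrow> real \<Rightarrow> real ^ 'n \<Rightarrow> real" where
  "linear_power c q x = (c \<bullet> x) powr q"

definition shifted_cube :: "real ^ 'n \<Rightarrow> real \<Rightarrow> (real ^ 'n) set" where
  "shifted_cube v u = (\<lambda>y. v + u *\<^sub>R y) ` cbox 0 1"

end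

theory Submission
  imports Defs
begin

text \<open>Let \<open>S\<close> be the set whose closed convex hull is the perspective relaxation. The perspective of a
  concave function is jointly concave, and that of a convex function is jointly convex, so \<open>S\<close> is
  convex; it is bounded because \<open>f\<close> is nonnegative and \<open>\<mu>\<close> is bounded above on the cube. The
  frontier of a convex set is a null set; therefore \<open>S\<close> is measurable without any further
  regularity of \<open>\<mu>\<close>, and it has the same volume as the perspective relaxation.

  Since \<open>f\<close> is homogeneous of degree \<open>q \<ge> 1\<close>, \<open>f x = z powr q * f (x /\<^sub>R z)\<close> lies below
  \<open>z * f (x /\<^sub>R z)\<close> for \<open>0 < z \<le> 1\<close>. Up to the apex, the naive relaxation is thus the disjoint
  union of \<open>S\<close> and the set of all \<open>(x, y, z)\<close> with \<open>0 < z \<le> 1\<close>, \<open>x /\<^sub>R z \<in> Q\<close> and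
  \<open>f x \<le> y < z * f (x /\<^sub>R z)\<close>, which does not depend on \<open>\<mu>\<close>. By Fubini and the substitution \<open>x = z *\<^sub>R w\<close>, this set has volume
  \<open>(\<integral>z\<in>{0..1}. z ^ d * (z - z powr q)) * (\<integral>w\<in>Q. f w)\<close>
  (\<open>emeasure_relaxation_gap\<close>), where the first factor is \<open>1 / (d + 2) - 1 / (q + d + 1)\<close>. An
  affine substitution turns the second factor into the integral over the unit cube
  (\<open>nn_integral_linear_power_shifted_cube\<close>).\<close>

section \<open>Perspectives of concave and convex functions\<close>

lemma perspective_minus: "perspective (\<lambda>x. - g x) x z = - perspective g x z"
  by (simp add: perspective_def)

lemma perspective_of_scaled: "z > 0 \<Longrightarrow> perspective g (z *\<^sub>R w) z = z * g w"
  by (simp add: perspective_def)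

lemma mem_scaled_image_iff:
  fixes Q :: "'a::real_vector set"
  assumes "z > 0"
  shows "x \<in> (\<lambda>w. z *\<^sub>R w) ` Q \<longleftrightarrow> x /\<^sub>R z \<in> Q"
proof
  assume "x /\<^sub>R z \<in> Q"
  then have "z *\<^sub>R (x /\<^sub>R z) \<in> (\<lambda>w. z *\<^sub>R w) ` Q"
    by (rule imageI)
  then show "x \<in> (\<lambda>w. z *\<^sub>R w) ` Q"
    using assms by simp
qed (use assms in auto)

text \<open>The convex combination of two points of the cone over \<open>Q\<close> is described by a convex
  combination of the base points, with weights proportional to \<open>a * z1\<close> and \<open>b * z2\<close>.\<close>

lemma perspective_concave:
  fixes g :: "'a::real_vector \<Rightarrow> real"
  assumes g: "concave_on Q g" and w: "w1 \<in> Q" "w2 \<in> Q" and z: "z1 > 0" "z2 > 0"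
    and ab: "a \<ge> 0" "b \<ge> 0" "a + b = 1"
  shows "a *\<^sub>R (z1 *\<^sub>R w1) + b *\<^sub>R (z2 *\<^sub>R w2) \<in> (\<lambda>w. (a * z1 + b * z2) *\<^sub>R w) ` Q"
    and "a * perspective g (z1 *\<^sub>R w1) z1 + b * perspective g (z2 *\<^sub>R w2) z2
      \<le> perspective g (a *\<^sub>R (z1 *\<^sub>R w1) + b *\<^sub>R (z2 *\<^sub>R w2)) (a * z1 + b * z2)"
proof -
  define z where "z = a * z1 + b * z2"
  have zpos: "z > 0"
    using z ab unfolding z_def
    by (cases "a = 0") (auto intro!: add_pos_nonneg mult_pos_pos)
  define s t where "s = a * z1 / z" and "t = b * z2 / z"
  have st: "s \<ge> 0" "t \<ge> 0"
    using ab z zpos by (auto simp: s_def t_def)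
  have st1: "s + t = 1"
    using zpos by (simp add: s_def t_def z_def flip: add_divide_distrib)
  define w where "w = s *\<^sub>R w1 + t *\<^sub>R w2"
  have eq: "a *\<^sub>R (z1 *\<^sub>R w1) + b *\<^sub>R (z2 *\<^sub>R w2) = z *\<^sub>R w"
    using zpos by (simp add: w_def s_def t_def algebra_simps)
  have wQ: "w \<in> Q"
    using concave_on_imp_convex[OF g] w st st1 unfolding w_def convex_def by blast
  then show "a *\<^sub>R (z1 *\<^sub>R w1) + b *\<^sub>R (z2 *\<^sub>R w2) \<in> (\<lambda>w. (a * z1 + b * z2) *\<^sub>R w) ` Q"
    unfolding eq z_def[symmetric] by blast
  have "s * g w1 + t * g w2 \<le> g w"
    using g w st st1 unfolding w_def concave_on_iff by blast
  then have "z * (s * g w1 + t * g w2) \<le> z * g w"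
    using zpos by simp
  moreover have "z * (s * g w1 + t * g w2) = a * (z1 * g w1) + b * (z2 * g w2)"
    using zpos by (simp add: s_def t_def algebra_simps)
  ultimately show "a * perspective g (z1 *\<^sub>R w1) z1 + b * perspective g (z2 *\<^sub>R w2) z2
      \<le> perspective g (a *\<^sub>R (z1 *\<^sub>R w1) + b *\<^sub>R (z2 *\<^sub>R w2)) (a * z1 + b * z2)"
    unfolding eq z_def[symmetric] using z zpos by (simp add: perspective_of_scaled)
qed

text \<open>The set whose closed convex hull is the perspective relaxation: a cone, truncated at
  \<open>z = 1\<close> and without its apex, over the region between the graphs of \<open>f\<close> and \<open>\<mu>\<close> on \<open>Q\<close>.\<close>

definition perspective_body ::
  "('a::euclidean_space \<Rightarrow> real) \<Rightarrow> ('a \<Rightarrow> real) \<Rightarrow> 'a set \<Rightarrow> ('a \<times> real \<times> real) set" where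
  "perspective_body f \<mu> Q = {(x, y, z). perspective \<mu> x z \<ge> y \<and> y \<ge> perspective f x z \<and>
                 x \<in> (\<lambda>q. z *\<^sub>R q) ` Q \<and> 1 \<ge> z \<and> z > 0}"

lemma convex_perspective_body:
  assumes f: "convex_on Q f" and \<mu>: "concave_on Q \<mu>"
  shows "convex (perspective_body f \<mu> Q)"
proof (rule convexI, clarsimp simp: perspective_body_def, intro conjI)
  fix w1 w2 and y1 y2 z1 z2 a b :: real
  assume w: "w1 \<in> Q" "w2 \<in> Q" and z: "0 < z1" "z1 \<le> 1" "0 < z2" "z2 \<le> 1"
    and ab: "0 \<le> a" "0 \<le> b" "a + b = 1"
    and y1: "y1 \<le> perspective \<mu> (z1 *\<^sub>R w1) z1" "perspective f (z1 *\<^sub>R w1) z1 \<le> y1"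
    and y2: "y2 \<le> perspective \<mu> (z2 *\<^sub>R w2) z2" "perspective f (z2 *\<^sub>R w2) z2 \<le> y2"
  let ?x = "a *\<^sub>R (z1 *\<^sub>R w1) + b *\<^sub>R (z2 *\<^sub>R w2)"
  have mf: "concave_on Q (\<lambda>x. - f x)"
    using f by (simp add: concave_on_def)
  have "a * y1 + b * y2
      \<le> a * perspective \<mu> (z1 *\<^sub>R w1) z1 + b * perspective \<mu> (z2 *\<^sub>R w2) z2"
    using y1 y2 ab by (intro add_mono mult_left_mono) auto
  also have "\<dots> \<le> perspective \<mu> ?x (a * z1 + b * z2)"
    by (rule perspective_concave[OF \<mu> w z(1,3) ab])
  finally show "a * y1 + b * y2
      \<le> perspective \<mu> ((a * z1) *\<^sub>R w1 + (b * z2) *\<^sub>R w2) (a * z1 + b * z2)"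
    by simp
  have "perspective f ?x (a * z1 + b * z2)
      \<le> a * perspective f (z1 *\<^sub>R w1) z1 + b * perspective f (z2 *\<^sub>R w2) z2"
    using perspective_concave(2)[OF mf w z(1,3) ab] by (simp add: perspective_minus)
  also have "\<dots> \<le> a * y1 + b * y2"
    using y1 y2 ab by (intro add_mono mult_left_mono) auto
  finally show "perspective f ((a * z1) *\<^sub>R w1 + (b * z2) *\<^sub>R w2) (a * z1 + b * z2)
      \<le> a * y1 + b * y2"
    by simp
  show "(a * z1) *\<^sub>R w1 + (b * z2) *\<^sub>R w2 \<in> (*\<^sub>R) (a * z1 + b * z2) ` Q"
    using perspective_concave(1)[OF \<mu> w z(1,3) ab] by simp
  have "a * z1 + b * z2 \<le> a * 1 + b * 1"
    using z ab by (intro add_mono mult_left_mono) auto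
  then show "a * z1 + b * z2 \<le> 1"
    using ab by simp
  show "0 < a * z1 + b * z2"
    using z ab by (cases "a = 0") (auto intro!: add_pos_nonneg mult_pos_pos)
qed

lemma bounded_perspective_body:
  assumes Q: "bounded Q" and f: "\<And>x. x \<in> Q \<Longrightarrow> 0 \<le> f x" and \<mu>: "\<And>x. x \<in> Q \<Longrightarrow> \<mu> x \<le> M"
  shows "bounded (perspective_body f \<mu> Q)"
proof -
  obtain B where B: "\<And>x. x \<in> Q \<Longrightarrow> norm x \<le> B"
    using Q unfolding bounded_iff by blast
  have "perspective_body f \<mu> Q \<subseteq> cball 0 B \<times> {0..M} \<times> {0..1}"
  proof
    fix p
    assume "p \<in> perspective_body f \<mu> Q"
    then obtain w y z where p: "p = (z *\<^sub>R w, y, z)" and w: "w \<in> Q"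
      and z: "0 < z" "z \<le> 1" and y: "y \<le> z * \<mu> w" "z * f w \<le> y"
      by (auto simp: perspective_body_def perspective_of_scaled)
    have f0: "0 \<le> f w" and fM: "\<mu> w \<le> M"
      using f \<mu> w by auto
    have y0: "0 \<le> y"
      using f0 z y by (smt (verit) mult_nonneg_nonneg)
    then have "0 \<le> \<mu> w"
      using z y by (smt (verit) mult_pos_neg)
    then have "z * \<mu> w \<le> \<mu> w"
      using z by (simp add: mult_left_le_one_le)
    moreover have "z * norm w \<le> norm w"
      using z by (simp add: mult_left_le_one_le)
    ultimately show "p \<in> cball 0 B \<times> {0..M} \<times> {0..1}"
      using B[OF w] y y0 fM z by (simp add: p)
  qed
  then show ?thesis
    by (rule bounded_subset[rotated]) (intro bounded_Times bounded_cball bounded_closed_interval)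
qed

text \<open>A concave function that is bounded below on a point-symmetric set is bounded above there:
  its value at the centre dominates the mean of its values at opposite points.\<close>

lemma concave_on_symmetric_bounded_above:
  fixes g :: "'a::real_vector \<Rightarrow> real"
  assumes g: "concave_on Q g" and sym: "2 *\<^sub>R m - x \<in> Q" and x: "x \<in> Q"
    and L: "\<And>x. x \<in> Q \<Longrightarrow> L \<le> g x"
  shows "g x \<le> 2 * g m - L"
proof -
  have "(1/2) * g x + (1/2) * g (2 *\<^sub>R m - x) \<le> g ((1/2) *\<^sub>R x + (1/2) *\<^sub>R (2 *\<^sub>R m - x))"
    using g x sym unfolding concave_on_iff by (smt (verit) field_sum_of_halves)
  also have "(1/2) *\<^sub>R x + (1/2) *\<^sub>R (2 *\<^sub>R m - x) = m"
    by (simp add: algebra_simps)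
  finally show ?thesis
    using L[OF sym] by simp
qed

section \<open>The region between the two relaxations\<close>

text \<open>If \<open>f\<close> is nonnegative and homogeneous of degree at least one on \<open>Q\<close> and \<open>f \<le> \<mu>\<close> there, then
  these are the points that the naive relaxation contains in addition to
  \<open>perspective_body f \<mu> Q\<close>, except for the apex. The bound \<open>\<mu>\<close> does not enter.\<close>

definition relaxation_gap ::
  "('a::euclidean_space \<Rightarrow> real) \<Rightarrow> 'a set \<Rightarrow> ('a \<times> real \<times> real) set" where
  "relaxation_gap f Q =
     {(x, y, z). 0 < z \<and> z \<le> 1 \<and> x /\<^sub>R z \<in> Q \<and> f x \<le> y \<and> y < z * f (x /\<^sub>R z)}"

lemma nn_integral_lborel_affine:
  fixes g :: "'a::euclidean_space \<Rightarrow> ennreal"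
  assumes [measurable]: "g \<in> borel_measurable borel" and s: "s > 0"
  shows "(\<integral>\<^sup>+x. g x \<partial>lborel) = ennreal (s ^ DIM('a)) * (\<integral>\<^sup>+x. g (t + s *\<^sub>R x) \<partial>lborel)"
proof -
  have "(\<integral>\<^sup>+x. g x \<partial>lborel) =
      (\<integral>\<^sup>+x. g x \<partial>density (distr lborel borel (\<lambda>x. t + s *\<^sub>R x)) (\<lambda>_. \<bar>s\<bar>^DIM('a)))"
    using s by (subst lborel_affine[of s t]) auto
  also have "\<dots> = ennreal (s ^ DIM('a)) * (\<integral>\<^sup>+x. g (t + s *\<^sub>R x) \<partial>lborel)"
    using s by (simp add: nn_integral_density nn_integral_distr nn_integral_cmult)
  finally show ?thesis .
qed

lemma nn_integral_powr_diff:
  fixes q d :: real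
  assumes q: "q \<ge> 1" and d: "d \<ge> 0"
  shows "(\<integral>\<^sup>+z. ennreal (z powr (d + 1) - z powr (d + q)) * indicator {0..1} z \<partial>lborel)
    = ennreal ((q - 1) / ((d + 2) * (q + d + 1)))"
proof -
  have "((\<lambda>z::real. z powr (d + 1) - z powr (d + q)) has_integral
      (1 powr (d + 1 + 1) / (d + 1 + 1) - 1 powr (d + q + 1) / (d + q + 1))) {0..1}"
    using q d by (intro has_integral_diff has_integral_powr_from_0) auto
  also have "1 powr (d + 1 + 1) / (d + 1 + 1) - 1 powr (d + q + 1) / (d + q + 1)
      = (q - 1) / ((d + 2) * (q + d + 1))"
    using q d by (simp add: field_simps)
  finally have I: "((\<lambda>z::real. z powr (d + 1) - z powr (d + q)) has_integral
      (q - 1) / ((d + 2) * (q + d + 1))) {0..1}" .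
  show ?thesis
    using q by (intro nn_integral_has_integral_lebesgue' I) (auto intro!: powr_mono')
qed

text \<open>At height \<open>z\<close> with \<open>0 < z \<le> 1\<close> the gap lies over the dilate of \<open>Q\<close> by \<open>z\<close> with
  thickness \<open>(z - z powr q) * f (x /\<^sub>R z)\<close>, so its slice has volume \<open>z ^ d * (z - z powr q)\<close> times the integral of \<open>f\<close> over \<open>Q\<close>, where
  \<open>d\<close> is the dimension.\<close>

proposition emeasure_relaxation_gap:
  fixes f :: "'a::euclidean_space \<Rightarrow> real"
  assumes Q[measurable]: "Q \<in> sets borel" and f[measurable]: "f \<in> borel_measurable borel"
    and nonneg: "\<And>x. x \<in> Q \<Longrightarrow> 0 \<le> f x"
    and homogeneous: "\<And>x z. x \<in> Q \<Longrightarrow> 0 < z \<Longrightarrow> f (z *\<^sub>R x) = z powr q * f x"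
    and q: "q \<ge> 1"
  shows "relaxation_gap f Q \<in> sets borel"
    and "emeasure lborel (relaxation_gap f Q) =
      ennreal ((q - 1) / ((real DIM('a) + 2) * (q + real DIM('a) + 1))) *
      (\<integral>\<^sup>+x. ennreal (f x) * indicator Q x \<partial>lborel)"
proof -
  let ?D = "relaxation_gap f Q" and ?d = "DIM('a)"
  let ?J = "\<integral>\<^sup>+x. ennreal (f x) * indicator Q x \<partial>lborel"
  have "?D = {p \<in> space borel. 0 < snd (snd p) \<and> snd (snd p) \<le> 1 \<and> fst p /\<^sub>R snd (snd p) \<in> Q \<and>
      f (fst p) \<le> fst (snd p) \<and> fst (snd p) < snd (snd p) * f (fst p /\<^sub>R snd (snd p))}"
    by (auto simp: relaxation_gap_def)
  also have "\<dots> \<in> sets borel"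
    unfolding borel_prod[symmetric] by measurable
  finally show D: "?D \<in> sets borel" .
  have prod3: "lborel \<Otimes>\<^sub>M (lborel \<Otimes>\<^sub>M lborel) = (lborel :: ('a \<times> real \<times> real) measure)"
    unfolding lborel_prod ..
  have [measurable]: "?D \<in> sets (lborel \<Otimes>\<^sub>M (lborel \<Otimes>\<^sub>M lborel))"
    unfolding prod3 using D by simp
  have thickness:
    "(\<integral>\<^sup>+y. indicator ?D (x, y, z) \<partial>lborel) =
      ennreal ((z - z powr q) * f (x /\<^sub>R z)) * indicator Q (x /\<^sub>R z)"
    if z: "0 < z" "z \<le> 1" for x and z :: real
  proof (cases "x /\<^sub>R z \<in> Q")
    case True
    have fx: "f x = z powr q * f (x /\<^sub>R z)"
      using homogeneous[OF True z(1)] z by simp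
    have "z powr q \<le> z powr 1"
      using z q by (intro powr_mono') auto
    then have le: "f x \<le> z * f (x /\<^sub>R z)"
      unfolding fx using nonneg[OF True] z by (intro mult_right_mono) auto
    have "(\<integral>\<^sup>+y. indicator ?D (x, y, z) \<partial>lborel)
        = (\<integral>\<^sup>+y. indicator {f x..<z * f (x /\<^sub>R z)} y \<partial>lborel)"
      using True z by (intro nn_integral_cong) (auto simp: relaxation_gap_def indicator_def)
    then show ?thesis
      using True le by (simp add: fx algebra_simps)
  qed (simp add: relaxation_gap_def indicator_def)
  have slice:
    "(\<integral>\<^sup>+x. \<integral>\<^sup>+y. indicator ?D (x, y, z) \<partial>lborel \<partial>lborel) =
      ennreal (z powr (real ?d + 1) - z powr (real ?d + q)) * indicator {0..1} z * ?J" for z :: real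
  proof (cases "0 < z \<and> z \<le> 1")
    case z: True
    have "z powr q \<le> z powr 1"
      using z q by (intro powr_mono') auto
    then have zq: "0 \<le> z - z powr q"
      using z by simp
    have "(\<integral>\<^sup>+x. \<integral>\<^sup>+y. indicator ?D (x, y, z) \<partial>lborel \<partial>lborel)
        = (\<integral>\<^sup>+x. ennreal ((z - z powr q) * f (x /\<^sub>R z)) * indicator Q (x /\<^sub>R z) \<partial>lborel)"
      using z thickness by simp
    also have "\<dots> = ennreal (z ^ ?d) *
        (\<integral>\<^sup>+w. ennreal ((z - z powr q) * f w) * indicator Q w \<partial>lborel)"
      using z by (subst nn_integral_lborel_affine[where t = 0 and s = z]) auto
    also have "(\<integral>\<^sup>+w. ennreal ((z - z powr q) * f w) * indicator Q w \<partial>lborel)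
        = (\<integral>\<^sup>+w. ennreal (z - z powr q) * (ennreal (f w) * indicator Q w) \<partial>lborel)"
      using zq nonneg by (intro nn_integral_cong) (auto simp: ennreal_mult indicator_def)
    also have "\<dots> = ennreal (z - z powr q) * ?J"
      by (rule nn_integral_cmult) measurable
    also have "ennreal (z ^ ?d) * (ennreal (z - z powr q) * ?J)
        = ennreal (z ^ ?d * (z - z powr q)) * ?J"
      using z zq by (simp add: ennreal_mult mult.assoc)
    also have "z ^ ?d * (z - z powr q) = z powr (real ?d + 1) - z powr (real ?d + q)"
      using z by (simp add: powr_add powr_realpow algebra_simps)
    finally show ?thesis
      using z by simp
  next
    case False
    \<comment> \<open>Only \<open>z = 0\<close> is left inside \<open>{0..1}\<close>, and there both powers vanish.\<close>
    then have "ennreal (z powr (real ?d + 1) - z powr (real ?d + q)) * indicator {0..1} z = 0"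
      by (cases "z = 0") (auto simp: indicator_def)
    moreover have "indicator ?D (x, y, z) = (0 :: ennreal)" for x y
      using False by (auto simp: relaxation_gap_def indicator_def)
    ultimately show ?thesis
      by simp
  qed
  have "emeasure lborel ?D = (\<integral>\<^sup>+p. indicator ?D p \<partial>(lborel \<Otimes>\<^sub>M (lborel \<Otimes>\<^sub>M lborel)))"
    unfolding prod3 using D by simp
  also have "\<dots> = (\<integral>\<^sup>+x. \<integral>\<^sup>+p. indicator ?D (x, p) \<partial>(lborel \<Otimes>\<^sub>M lborel) \<partial>lborel)"
  proof (rule sigma_finite_measure.nn_integral_fst[symmetric])
    show "sigma_finite_measure (lborel \<Otimes>\<^sub>M lborel :: (real \<times> real) measure)"
      unfolding lborel_prod by (rule lborel.sigma_finite_measure_axioms)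
  qed measurable
  also have "\<dots> = (\<integral>\<^sup>+x. \<integral>\<^sup>+z. \<integral>\<^sup>+y. indicator ?D (x, y, z) \<partial>lborel \<partial>lborel \<partial>lborel)"
    by (intro nn_integral_cong lborel_pair.nn_integral_snd[symmetric]) measurable
  also have "\<dots> = (\<integral>\<^sup>+z. \<integral>\<^sup>+x. \<integral>\<^sup>+y. indicator ?D (x, y, z) \<partial>lborel \<partial>lborel \<partial>lborel)"
    by (intro lborel_pair.Fubini') measurable
  also have "\<dots> = (\<integral>\<^sup>+z. ennreal (z powr (real ?d + 1) - z powr (real ?d + q)) * indicator {0..1} z * ?J
      \<partial>lborel)"
    unfolding slice ..
  also have "\<dots> = (\<integral>\<^sup>+z. ennreal (z powr (real ?d + 1) - z powr (real ?d + q)) * indicator {0..1} z \<partial>lborel)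
      * ?J"
    by (rule nn_integral_multc) measurable
  also have "(\<integral>\<^sup>+z. ennreal (z powr (real ?d + 1) - z powr (real ?d + q)) * indicator {0..1} z \<partial>lborel)
      = ennreal ((q - 1) / ((real ?d + 2) * (q + real ?d + 1)))"
    using nn_integral_powr_diff[OF q, of "real ?d"] by simp
  finally show "emeasure lborel ?D =
      ennreal ((q - 1) / ((real ?d + 2) * (q + real ?d + 1))) * ?J" .
qed

text \<open>For homogeneous \<open>f\<close> the difference of the two volumes is therefore independent of \<open>\<mu>\<close>.\<close>

theorem vol_diff_homogeneous:
  fixes f :: "'a::euclidean_space \<Rightarrow> real"
  assumes Q: "compact Q" "Q \<noteq> {}" and f: "f \<in> borel_measurable borel" "convex_on Q f"
    and nonneg: "\<And>x. x \<in> Q \<Longrightarrow> 0 \<le> f x" and f0: "f 0 = 0"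
    and homogeneous: "\<And>x z. x \<in> Q \<Longrightarrow> 0 < z \<Longrightarrow> f (z *\<^sub>R x) = z powr q * f x"
    and q: "q \<ge> 1"
    and \<mu>: "concave_upper_bound f Q \<mu>" and M: "\<And>x. x \<in> Q \<Longrightarrow> \<mu> x \<le> M"
    and J: "(\<integral>\<^sup>+x. ennreal (f x) * indicator Q x \<partial>lborel) = ennreal J" "J \<ge> 0"
  shows "vol_diff (naive_relaxation f \<mu> Q) (perspective_relaxation f \<mu> Q)
    = (q - 1) / ((real DIM('a) + 2) * (q + real DIM('a) + 1)) * J"
proof -
  let ?S = "perspective_body f \<mu> Q" and ?D = "relaxation_gap f Q"
  let ?k = "(q - 1) / ((real DIM('a) + 2) * (q + real DIM('a) + 1))"
  have conc: "concave_on Q \<mu>" and ub: "\<And>x. x \<in> Q \<Longrightarrow> f x \<le> \<mu> x"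
    using \<mu> by (auto simp: concave_upper_bound_def)
  have conv: "convex ?S"
    using convex_perspective_body[OF f(2) conc] .
  have S: "?S \<in> lmeasurable"
    using conv bounded_perspective_body[OF compact_imp_bounded[OF Q(1)] nonneg M]
    by (rule measurable_convex)
  have Qb: "Q \<in> sets borel"
    using Q(1) by (simp add: borel_compact)
  have gap: "?D \<in> sets borel"
    "emeasure lborel ?D = ennreal ?k * (\<integral>\<^sup>+x. ennreal (f x) * indicator Q x \<partial>lborel)"
    by (rule emeasure_relaxation_gap[OF Qb f(1) nonneg homogeneous q]; assumption)+
  have k: "?k \<ge> 0"
    using q by simp
  have "emeasure lebesgue ?D = emeasure lborel ?D"
    using gap(1) by simp
  also have "\<dots> = ennreal (?k * J)"
    unfolding gap(2) J(1) using k J(2) by (rule ennreal_mult[symmetric])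
  finally have eD: "emeasure lebesgue ?D = ennreal (?k * J)" .
  have D: "?D \<in> lmeasurable"
    using gap(1) eD by (intro fmeasurableI) auto
  have mD: "measure lebesgue ?D = ?k * J"
    unfolding measure_def eD using k J(2) by (intro enn2real_ennreal mult_nonneg_nonneg)
  have perspective: "measure lebesgue (perspective_relaxation f \<mu> Q) = measure lebesgue ?S"
  proof -
    have "perspective_relaxation f \<mu> Q = closure ?S"
      using hull_same[of convex, OF conv]
      by (simp add: perspective_relaxation_def perspective_body_def)
    moreover have "measure lebesgue (closure ?S) = measure lebesgue ?S"
    proof (rule measure_negligible_symdiff[OF S])
      show "negligible (?S - closure ?S \<union> (closure ?S - ?S))"
        using negligible_convex_frontier[OF conv]
        by (rule negligible_subset) (use closure_subset interior_subset in \<open>auto simp: frontier_def\<close>)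
    qed
    ultimately show ?thesis
      by simp
  qed
  have f_le: "f x \<le> z * f (x /\<^sub>R z)" if "0 < z" "z \<le> 1" "x /\<^sub>R z \<in> Q" for x z
  proof -
    have "f x = z powr q * f (x /\<^sub>R z)"
      using homogeneous[OF that(3,1)] that(1) by simp
    also have "z powr q \<le> z powr 1"
      using that q by (intro powr_mono') auto
    then have "z powr q * f (x /\<^sub>R z) \<le> z * f (x /\<^sub>R z)"
      using that nonneg by (intro mult_right_mono) auto
    finally show ?thesis .
  qed
  have naive: "naive_relaxation f \<mu> Q = (?S \<union> ?D) \<union> {(0, 0, 0)}"
  proof (rule set_eqI, clarify)
    fix x and y z :: real
    consider "z < 0" | "z = 0" | "z > 1" | "0 < z" "z \<le> 1"
      by linarith
    then show "(x, y, z) \<in> naive_relaxation f \<mu> Q \<longleftrightarrow> (x, y, z) \<in> (?S \<union> ?D) \<union> {(0, 0, 0)}"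
    proof cases
      case 2
      then show ?thesis
        using Q(2) by (auto simp: naive_relaxation_def perspective_body_def relaxation_gap_def
            perspective_def f0)
    next
      case 4
      have "y \<le> z * \<mu> (x /\<^sub>R z)" if "x /\<^sub>R z \<in> Q" "y < z * f (x /\<^sub>R z)"
        using that(2) mult_left_mono[OF ub[OF that(1)], of z] 4 by linarith
      then show ?thesis
        using 4 f_le[of z x]
        by (auto simp: naive_relaxation_def perspective_body_def relaxation_gap_def
            mem_scaled_image_iff perspective_def)
    qed (auto simp: naive_relaxation_def perspective_body_def relaxation_gap_def)
  qed
  have "measure lebesgue (naive_relaxation f \<mu> Q) = measure lebesgue (?S \<union> ?D)"
    unfolding naive
    by (rule measure_negligible_symdiff[OF fmeasurable.Un[OF S D]])
      (auto intro: negligible_subset[of "{(0, 0, 0)}"])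
  also have "\<dots> = measure lebesgue ?S + measure lebesgue ?D"
  proof (rule measure_Union)
    show "?S \<inter> ?D = {}"
      by (auto simp: perspective_body_def relaxation_gap_def perspective_def)
  qed (use S D in \<open>simp_all add: fmeasurableD fmeasurableD2 del: emeasure_completion\<close>)
  finally show ?thesis
    unfolding vol_diff_def perspective mD by simp
qed

section \<open>Powers of a positive linear function on a cube\<close>

lemma convex_on_linear_power:
  assumes "q \<ge> 1" "convex Q" "\<And>x. x \<in> Q \<Longrightarrow> 0 < c \<bullet> x"
  shows "convex_on Q (linear_power c q)"
proof -
  have "linear_power c q (a *\<^sub>R x + b *\<^sub>R y) \<le> a * linear_power c q x + b * linear_power c q y"
    if "x \<in> Q" "y \<in> Q" "0 \<le> a" "0 \<le> b" "a + b = 1" for x y a b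
  proof -
    have "(a *\<^sub>R (c \<bullet> x) + b *\<^sub>R (c \<bullet> y)) powr q \<le> a * (c \<bullet> x) powr q + b * (c \<bullet> y) powr q"
      using powr_convex[OF assms(1)] assms(3) that unfolding convex_on_def
      by (metis greaterThan_iff)
    then show ?thesis
      by (simp add: linear_power_def inner_add_right)
  qed
  then show ?thesis
    using assms(2) by (simp add: convex_on_def)
qed

lemma linear_power_scaleR: "linear_power c q (z *\<^sub>R x) = z powr q * linear_power c q x"
  by (simp add: linear_power_def powr_mult)

lemma linear_power_zero: "linear_power c q 0 = 0"
  by (simp add: linear_power_def)

lemma borel_measurable_linear_power: "linear_power c q \<in> borel_measurable borel"
  unfolding linear_power_def by measurable

lemma compact_shifted_cube: "compact (shifted_cube v u)"
  unfolding shifted_cube_def by (intro compact_continuous_image continuous_intros compact_cbox)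

lemma convex_shifted_cube: "convex (shifted_cube v u)"
proof -
  have "shifted_cube v u = (+) v ` (*\<^sub>R) u ` cbox 0 1"
    by (simp add: shifted_cube_def image_image)
  then show ?thesis
    by (simp add: convex_translation convex_scaling convex_box)
qed

lemma shifted_cube_symmetric:
  assumes "x \<in> shifted_cube v u"
  shows "2 *\<^sub>R (v + (u / 2) *\<^sub>R 1) - x \<in> shifted_cube v u"
proof -
  obtain y where y: "y \<in> cbox 0 1" "x = v + u *\<^sub>R y"
    using assms by (auto simp: shifted_cube_def)
  have "1 - y \<in> cbox 0 1"
    using y(1) by (simp add: mem_box_cart)
  then have "v + u *\<^sub>R (1 - y) \<in> shifted_cube v u"
    unfolding shifted_cube_def by (rule imageI)
  moreover have "2 *\<^sub>R (v + (u / 2) *\<^sub>R 1) - x = v + u *\<^sub>R (1 - y)"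
    by (simp add: y(2) algebra_simps scaleR_2)
  ultimately show ?thesis
    by simp
qed

lemma inner_pos_shifted_cube:
  fixes c v :: "real ^ 'n"
  assumes c: "\<And>i. c $ i > 0" and v: "\<And>i. v $ i > 0" and u: "u > 0"
    and x: "x \<in> shifted_cube v u"
  shows "0 < c \<bullet> x"
proof -
  have "0 < c $ i * x $ i" for i
    using c[of i] v[of i] u x
    by (auto simp: shifted_cube_def mem_box_cart intro!: mult_pos_pos add_pos_nonneg)
  then show ?thesis
    by (auto simp: inner_vec_def intro!: sum_pos)
qed

lemma nn_integral_linear_power_shifted_cube:
  fixes c v :: "real ^ 'n"
  assumes c: "\<And>i. c $ i > 0" and v: "\<And>i. v $ i > 0" and u: "u > 0" and q: "q \<ge> 1"
  shows "(\<integral>\<^sup>+x. ennreal (linear_power c q x) * indicator (shifted_cube v u) x \<partial>lborel)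
    = ennreal (u powr (q + real CARD('n)) *
        integral (cbox 0 1) (\<lambda>y :: real ^ 'n. (c \<bullet> y + (c \<bullet> v) / u) powr q))"
proof -
  let ?g = "\<lambda>y :: real ^ 'n. (c \<bullet> y + (c \<bullet> v) / u) powr q"
  have [measurable]: "shifted_cube v u \<in> sets borel"
    by (simp add: borel_compact compact_shifted_cube)
  note [measurable] = borel_measurable_linear_power
  have pos: "0 < c \<bullet> y + (c \<bullet> v) / u" if "y \<in> cbox 0 1" for y
  proof -
    have "0 < c \<bullet> (v + u *\<^sub>R y)"
      using that by (intro inner_pos_shifted_cube[OF c v u]) (auto simp: shifted_cube_def)
    also have "c \<bullet> (v + u *\<^sub>R y) = u * (c \<bullet> y + (c \<bullet> v) / u)"
      using u by (simp add: inner_add_right field_simps)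
    finally show ?thesis
      using u by (simp add: zero_less_mult_iff)
  qed
  have "continuous_on (cbox 0 1) ?g"
    using pos by (intro continuous_intros) force+
  then have I: "(?g has_integral integral (cbox 0 1) ?g) (cbox 0 1)"
    by (intro integrable_integral integrable_continuous)
  have mem: "v + u *\<^sub>R y \<in> shifted_cube v u \<longleftrightarrow> y \<in> cbox 0 1" for y
    using u by (auto simp: shifted_cube_def)
  have value_at: "linear_power c q (v + u *\<^sub>R y) = u powr q * ?g y" for y
  proof -
    have "c \<bullet> (v + u *\<^sub>R y) = u * (c \<bullet> y + (c \<bullet> v) / u)"
      using u by (simp add: inner_add_right field_simps)
    then show ?thesis
      by (simp add: linear_power_def powr_mult)
  qed
  have "(\<integral>\<^sup>+x. ennreal (linear_power c q x) * indicator (shifted_cube v u) x \<partial>lborel)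
      = ennreal (u ^ CARD('n)) *
        (\<integral>\<^sup>+y. ennreal (linear_power c q (v + u *\<^sub>R y)) *
          indicator (shifted_cube v u) (v + u *\<^sub>R y) \<partial>lborel)"
    using u by (subst nn_integral_lborel_affine[where t = v and s = u]) auto
  also have "(\<integral>\<^sup>+y. ennreal (linear_power c q (v + u *\<^sub>R y)) *
          indicator (shifted_cube v u) (v + u *\<^sub>R y) \<partial>lborel)
      = (\<integral>\<^sup>+y. ennreal (u powr q) * (ennreal (?g y) * indicator (cbox 0 1) y) \<partial>lborel)"
    by (intro nn_integral_cong) (simp add: value_at ennreal_mult mult.assoc mem indicator_def)
  also have "\<dots> = ennreal (u powr q) * (\<integral>\<^sup>+y. ennreal (?g y) * indicator (cbox 0 1) y \<partial>lborel)"
    by (rule nn_integral_cmult) measurable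
  also have "(\<integral>\<^sup>+y. ennreal (?g y) * indicator (cbox 0 1) y \<partial>lborel)
      = ennreal (integral (cbox 0 1) ?g)"
    by (rule nn_integral_has_integral_lebesgue'[OF _ I]) simp
  also have "ennreal (u ^ CARD('n)) * (ennreal (u powr q) * ennreal (integral (cbox 0 1) ?g))
      = ennreal (u powr (q + real CARD('n)) * integral (cbox 0 1) ?g)"
    using u by (simp add: powr_add powr_realpow ennreal_mult' mult_ac)
  finally show ?thesis .
qed

theorem corollary3p2:
  fixes q u :: real
    and c v\<^sub>0 :: "real ^ 'n"
    and \<mu> :: "real ^ 'n \<Rightarrow> real"
  assumes "q \<ge> 1"
    and "\<And>i. c $ i > 0"
    and "\<And>i. v\<^sub>0 $ i > 0"
    and "u > 0"
    and "concave_upper_bound (linear_power c q) (shifted_cube v\<^sub>0 u) \<mu>"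
  shows "vol_diff
           (naive_relaxation (linear_power c q) \<mu> (shifted_cube v\<^sub>0 u))
           (perspective_relaxation (linear_power c q) \<mu> (shifted_cube v\<^sub>0 u))
       = (q - 1) / ((real CARD('n) + 2) * (q + real CARD('n) + 1))
         * u powr (q + real CARD('n))
         * integral (cbox 0 1) (\<lambda>y :: real ^ 'n. (c \<bullet> y + (c \<bullet> v\<^sub>0) / u) powr q)"
proof -
  let ?f = "linear_power c q" and ?Q = "shifted_cube v\<^sub>0 u"
  \<comment> \<open>The centre of the cube, since \<open>1\<close> is the vector with all components one.\<close>
  let ?m = "v\<^sub>0 + (u / 2) *\<^sub>R 1"
  let ?J = "u powr (q + real CARD('n)) *
    integral (cbox 0 1) (\<lambda>y :: real ^ 'n. (c \<bullet> y + (c \<bullet> v\<^sub>0) / u) powr q)"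
  have nonneg: "0 \<le> ?f x" for x
    by (simp add: linear_power_def)
  have bound: "\<mu> x \<le> 2 * \<mu> ?m - 0" if "x \<in> ?Q" for x
    using assms(5) that nonneg
    by (intro concave_on_symmetric_bounded_above[of ?Q] shifted_cube_symmetric)
      (auto simp: concave_upper_bound_def intro: order_trans)
  have "cbox 0 (1 :: real ^ 'n) \<noteq> {}"
    by (simp add: interval_eq_empty_cart)
  then have ne: "?Q \<noteq> {}"
    by (simp add: shifted_cube_def)
  have "convex_on ?Q ?f"
    using inner_pos_shifted_cube[OF assms(2-4)]
    by (intro convex_on_linear_power assms convex_shifted_cube)
  moreover have "?J \<ge> 0"
    by (metis (no_types, lifting) integral_nonneg mult_nonneg_nonneg not_integrable_integral
        order_refl powr_ge_zero)
  ultimately have "vol_diff (naive_relaxation ?f \<mu> ?Q) (perspective_relaxation ?f \<mu> ?Q)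
      = (q - 1) / ((real DIM(real ^ 'n) + 2) * (q + real DIM(real ^ 'n) + 1)) * ?J"
    using nn_integral_linear_power_shifted_cube[OF assms(2-4,1)]
    by (intro vol_diff_homogeneous[OF compact_shifted_cube ne borel_measurable_linear_power _ _ _ _
          assms(1,5) bound])
      (auto simp: linear_power_scaleR nonneg linear_power_zero)
  then show ?thesis
    by simp
qed

end
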